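(* Let $\mathcal{A}$ be a pca, $s,t$ closed terms over $\mathcal{A}$, and $\alpha$ an ordinal. (i) If $s\sim_\alpha t$ then $sx\sim_\alpha tx$ for all $x\in\mathcal{A}$. (ii) If $s\sim_\beta t$ then $s\sim_\alpha t$ for all ordinals $\alpha\geq\beta$.
   Context: A pca is a set $\mathcal{A}$ with partial application $ab$ (associating to the left) containing $K,S$ with $Kab$ defined and equal to $a$, and $Sab$ defined with $Sabc\simeq ac(bc)$. Closed terms are built from elements by application; a closed term is defined if all subterms are defined; $s\simeq t$ means both undefined or both defined and equal. Relations $\sim_\alpha$ on closed terms: $s\sim_0 t$ iff $s\simeq t$; $s \sim_{\alpha+1} t$ iff $sx \sim_\alpha tx$ for all $x\in\mathcal{A}$; for limit $\alpha$, $s\sim_\alpha t$ iff $s\sim_\beta t$ for some $\beta<\alpha$. *)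

theory Defs
  imports Main
begin

datatype 'a cterm = Elem 'a | App "'a cterm" "'a cterm" (infixl "\<cdot>" 75)

text \<open>
  The set underlying the applicative structure is the type \<open>'a\<close>; \<open>app a b = None\<close> means that
  the application of \<open>a\<close> to \<open>b\<close> is undefined. Evaluation is strict, so a closed term has a value
  only if all of its subterms have one.
\<close>

fun cval :: "('a \<Rightarrow> 'a \<Rightarrow> 'a option) \<Rightarrow> 'a cterm \<Rightarrow> 'a option" where
  "cval app (Elem a) = Some a"
| "cval app (s \<cdot> t) =
     (case (cval app s, cval app t) of (Some a, Some b) \<Rightarrow> app a b | _ \<Rightarrow> None)"

definition is_defined :: "('a \<Rightarrow> 'a \<Rightarrow> 'a option) \<Rightarrow> 'a cterm \<Rightarrow> bool" where
  "is_defined app t \<longleftrightarrow> cval app t \<noteq> None"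

definition kleene_eq :: "('a \<Rightarrow> 'a \<Rightarrow> 'a option) \<Rightarrow> 'a cterm \<Rightarrow> 'a cterm \<Rightarrow> bool" where
  "kleene_eq app s t \<longleftrightarrow>
     (\<not> is_defined app s \<and> \<not> is_defined app t) \<or>
     (is_defined app s \<and> is_defined app t \<and> cval app s = cval app t)"

definition pca :: "('a \<Rightarrow> 'a \<Rightarrow> 'a option) \<Rightarrow> bool" where
  "pca app \<longleftrightarrow> (\<exists>K S.
     (\<forall>a b. cval app (Elem K \<cdot> Elem a \<cdot> Elem b) = Some a) \<and>
     (\<forall>a b. is_defined app (Elem S \<cdot> Elem a \<cdot> Elem b)) \<and>
     (\<forall>a b c. kleene_eq app (Elem S \<cdot> Elem a \<cdot> Elem b \<cdot> Elem c)
                             (Elem a \<cdot> Elem c \<cdot> (Elem b \<cdot> Elem c))))"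

text \<open>
  Ordinals are elements of an arbitrary well-ordered type: such an element stands for the order
  type of the set of its predecessors. Zero, successor and limit only depend on that set, hence
  so does the relation \<open>sim app \<alpha>\<close> below.
\<close>

definition ord_zero :: "'o::wellorder \<Rightarrow> bool" where
  "ord_zero \<alpha> \<longleftrightarrow> (\<forall>\<gamma>. \<not> \<gamma> < \<alpha>)"

definition ord_succ :: "'o::wellorder \<Rightarrow> 'o \<Rightarrow> bool" where
  \<comment> \<open>\<open>\<alpha> = \<beta> + 1\<close>\<close>
  "ord_succ \<beta> \<alpha> \<longleftrightarrow> (\<forall>\<gamma>. \<gamma> < \<alpha> \<longleftrightarrow> \<gamma> \<le> \<beta>)"

definition ord_limit :: "'o::wellorder \<Rightarrow> bool" where
  "ord_limit \<alpha> \<longleftrightarrow> \<not> ord_zero \<alpha> \<and> (\<nexists>\<beta>. ord_succ \<beta> \<alpha>)"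

lemma ord_succ_less: "ord_succ \<beta> \<alpha> \<Longrightarrow> \<beta> < \<alpha>"
  by (simp add: ord_succ_def)

lemma ord_succ_unique: "ord_succ \<beta> \<alpha> \<Longrightarrow> ord_succ \<gamma> \<alpha> \<Longrightarrow> \<beta> = \<gamma>"
  unfolding ord_succ_def by (metis order.antisym order.refl)

text \<open>
  The three disjuncts are mutually exclusive; the defining clauses for zero, successor and limit
  ordinals are the lemmas \<open>sim_zero\<close>, \<open>sim_succ\<close> and \<open>sim_limit\<close>.
\<close>

context
  notes conj_cong [fundef_cong]
begin

function sim ::
  "('a \<Rightarrow> 'a \<Rightarrow> 'a option) \<Rightarrow> 'o::wellorder \<Rightarrow> 'a cterm \<Rightarrow> 'a cterm \<Rightarrow> bool"
where
  "sim app \<alpha> s t \<longleftrightarrow>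
     (ord_zero \<alpha> \<and> kleene_eq app s t) \<or>
     (\<exists>\<beta>. ord_succ \<beta> \<alpha> \<and> (\<forall>x. sim app \<beta> (s \<cdot> Elem x) (t \<cdot> Elem x))) \<or>
     (ord_limit \<alpha> \<and> (\<exists>\<beta>. \<beta> < \<alpha> \<and> sim app \<beta> s t))"
  by auto
termination
  by (relation "inv_image {(x, y). x < y} (\<lambda>(app, \<alpha>, s, t). \<alpha>)")
     (auto intro: wf ord_succ_less)

end

declare sim.simps [simp del]

lemma sim_zero: "ord_zero \<alpha> \<Longrightarrow> sim app \<alpha> s t \<longleftrightarrow> kleene_eq app s t"
  using ord_succ_less by (subst sim.simps) (auto simp: ord_zero_def ord_limit_def)

lemma sim_succ:
  "ord_succ \<beta> \<alpha> \<Longrightarrow> sim app \<alpha> s t \<longleftrightarrow> (\<forall>x. sim app \<beta> (s \<cdot> Elem x) (t \<cdot> Elem x))"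
proof -
  assume succ: "ord_succ \<beta> \<alpha>"
  then have "\<not> ord_zero \<alpha>" "\<not> ord_limit \<alpha>"
    using ord_succ_less by (auto simp: ord_zero_def ord_limit_def)
  moreover have "ord_succ \<gamma> \<alpha> \<longleftrightarrow> \<gamma> = \<beta>" for \<gamma>
    using succ ord_succ_unique by blast
  ultimately show ?thesis
    by (subst sim.simps) simp
qed

lemma sim_limit: "ord_limit \<alpha> \<Longrightarrow> sim app \<alpha> s t \<longleftrightarrow> (\<exists>\<beta><\<alpha>. sim app \<beta> s t)"
  by (subst sim.simps) (auto simp: ord_limit_def)

end

theory Submission
  imports Defs
begin

text \<open>Both parts are transfinite inductions on \<alpha>. For (i), \<open>sim_App_Elem\<close>,
  equality of values survives application to an element, and the successor and limit clauses hand
  the claim down to a smaller ordinal. For (ii), \<open>sim_mono\<close>, the only real step is from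
  \<gamma> to its successor, and that step is exactly (i) at \<gamma>.\<close>

lemma ord_cases [case_names zero succ limit]:
  fixes \<alpha> :: "'o::wellorder"
  obtains "ord_zero \<alpha>" | \<beta> where "ord_succ \<beta> \<alpha>" | "ord_limit \<alpha>"
  unfolding ord_limit_def by blast

text \<open>Undefinedness is the value \<open>None\<close>, so the two disjuncts merge into one
  equation that rewriting can use under application.\<close>

lemma kleene_eq_iff_cval: "kleene_eq app s t \<longleftrightarrow> cval app s = cval app t"
  unfolding kleene_eq_def is_defined_def by metis

lemma sim_App_Elem:
  fixes \<alpha> :: "'o::wellorder"
  assumes "sim app \<alpha> s t"
  shows "sim app \<alpha> (s \<cdot> Elem x) (t \<cdot> Elem x)"
  using assms
proof (induction \<alpha> arbitrary: s t x rule: less_induct)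
  case (less \<alpha>)
  show ?case
  proof (cases \<alpha> rule: ord_cases)
    case zero
    then show ?thesis
      using less.prems by (simp add: sim_zero kleene_eq_iff_cval)
  next
    \<comment> \<open>The induction hypothesis at \<beta> is applied to the terms
      \<open>s \<cdot> Elem x\<close> and \<open>t \<cdot> Elem x\<close>, which is why the
      induction generalizes over \<open>s\<close> and \<open>t\<close>.\<close>
    case (succ \<beta>)
    then show ?thesis
      using less ord_succ_less[OF succ] by (simp add: sim_succ)
  next
    case limit
    then show ?thesis
      using less by (auto simp: sim_limit)
  qed
qed

lemma sim_mono:
  fixes \<alpha> \<beta> :: "'o::wellorder"
  assumes "sim app \<beta> s t" and "\<beta> \<le> \<alpha>"
  shows "sim app \<alpha> s t"
  using assms(2)
proof (induction \<alpha> rule: less_induct)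
  case (less \<alpha>)
  show ?case
  proof (cases "\<beta> = \<alpha>")
    case True
    then show ?thesis
      using assms(1) by simp
  next
    case False
    with less.prems have "\<beta> < \<alpha>"
      by simp
    show ?thesis
    proof (cases \<alpha> rule: ord_cases)
      case zero
      with \<open>\<beta> < \<alpha>\<close> show ?thesis
        by (simp add: ord_zero_def)
    next
      case (succ \<gamma>)
      with \<open>\<beta> < \<alpha>\<close> have "\<beta> \<le> \<gamma>"
        by (simp add: ord_succ_def)
      with less.IH ord_succ_less[OF succ] have "sim app \<gamma> s t"
        by blast
      \<comment> \<open>Unfolding the successor clause leaves \<open>sim app \<gamma>\<close> for
        \<open>s\<close> and \<open>t\<close> applied to each element: part (i) at \<gamma>.\<close>
      with succ show ?thesis
        by (simp add: sim_succ sim_App_Elem)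
    next
      case limit
      \<comment> \<open>\<beta> itself is the witness for the limit clause.\<close>
      with \<open>\<beta> < \<alpha>\<close> assms(1) show ?thesis
        by (auto simp: sim_limit)
    qed
  qed
qed

theorem theorem3p2:
  fixes app :: "'a \<Rightarrow> 'a \<Rightarrow> 'a option"
    and s t :: "'a cterm"
    and \<alpha> \<beta> :: "'o::wellorder"
  assumes "pca app"
  shows "(sim app \<alpha> s t \<longrightarrow> (\<forall>x. sim app \<alpha> (s \<cdot> Elem x) (t \<cdot> Elem x))) \<and>
         (sim app \<beta> s t \<longrightarrow> (\<forall>\<alpha>\<ge>\<beta>. sim app \<alpha> s t))"
  by (intro conjI impI allI) (erule sim_App_Elem, erule (1) sim_mono)

end
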